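(* Let $n \geq 4$. The $k$-faces of the half cube $h\gamma_n$ for $k < n$ are as follows: (i) $2^{n-1}$ $0$-faces (vertices), given by the elements of $\Psi^+_n$; (ii) $2^{n-2}\binom{n}{2}$ $1$-faces $\Pi(K(\mathbf{v}',S))$, where $\mathbf{v}' \in \Psi^-_n$ and $|S| = 2$; (iii) $2^{n-1}\binom{n}{3}$ simplex shaped $2$-faces $\Pi(K(\mathbf{v}',S))$, where $\mathbf{v}' \in \Psi^-_n$ and $|S| = 3$; (iv) $2^{n-1}\binom{n}{k+1}$ simplex shaped $k$-faces $\Pi(K(\mathbf{v}',S))$, where $\mathbf{v}' \in \Psi^-_n$ and $|S| = k+1$, for $3 \leq k < n$; (v) $2^{n-k}\binom{n}{k}$ half cube shaped $k$-faces $\Pi(L(\mathbf{v},S))$, where $\mathbf{v} \in \Psi^+_n$ and $|S| = k$, for $3 \leq k < n$. (Here $S \subseteq \mathbf{n} = \{1,\ldots,n\}$ throughout; for $k=3$ both (iv) and (v) contribute $3$-faces.)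
   Context: Let $\mathbf{n} = \{1,2,\ldots,n\}$. $\Psi_n = \{\pm 1\}^n \subset \mathbb{R}^n$ is the set of vertices of the hypercube; $\Psi^+_n$ is the subset of those with an even number of negative coordinates, and $\Psi^-_n = \Psi_n \setminus \Psi^+_n$. For a finite set $V \subset \mathbb{R}^n$, $\Pi(V)$ denotes its convex hull. The half cube is $h\gamma_n = \Pi(\Psi^+_n)$, an $n$-dimensional convex polytope; its facets are its codimension-one faces, and its $k$-faces are the $k$-dimensional polytopes obtained by repeatedly passing to facets (i.e. its $k$-dimensional faces in the usual sense), $0 \le k \le n$, with $h\gamma_n$ itself the $n$-face. For $\mathbf{v}' \in \Psi^-_n$ and nonempty $S \subseteq \mathbf{n}$, $K(\mathbf{v}',S)$ is the set of the $|S|$ points of $\Psi^+_n$ that differ from $\mathbf{v}'$ in exactly one coordinate $i$, with $i \in S$. For $\mathbf{v} \in \Psi^+_n$ and $S \subseteq \mathbf{n}$, $L(\mathbf{v},S)$ is the set of points of $\Psi^+_n$ that agree with $\mathbf{v}$ in the $i$-th coordinate for every $i \notin S$. "Simplex shaped" refers to the regular simplices $\Pi(K(\mathbf{v}',S))$; "half cube shaped" refers to $\Pi(L(\mathbf{v},S))$, which is isometric to $h\gamma_k$ when $|S| = k$ (for $k=3$ a regular tetrahedron). The numbers count distinct faces as $\mathbf{v}'$, $\mathbf{v}$ and $S$ vary. *)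

theory Defs
  imports "HOL-Analysis.Analysis"
begin

definition cube_vertices :: "(real^'n) set" where
  "cube_vertices = {v. \<forall>i. v $ i = 1 \<or> v $ i = - 1}"

definition even_vertices :: "(real^'n) set" where
  "even_vertices = {v \<in> cube_vertices. even (card {i. v $ i < 0})}"

definition odd_vertices :: "(real^'n) set" where
  "odd_vertices = cube_vertices - even_vertices"

definition half_cube :: "(real^'n) set" where
  "half_cube = convex hull even_vertices"

definition k_faces :: "(real^'n) set \<Rightarrow> nat \<Rightarrow> (real^'n) set set" where
  "k_faces P k = {F. F face_of P \<and> aff_dim F = int k}"

definition K_set :: "real^'n \<Rightarrow> 'n set \<Rightarrow> (real^'n) set" where
  "K_set v' S = {w \<in> even_vertices. \<exists>i\<in>S. {j. w $ j \<noteq> v' $ j} = {i}}"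

definition L_set :: "real^'n \<Rightarrow> 'n set \<Rightarrow> (real^'n) set" where
  "L_set v S = {w \<in> even_vertices. \<forall>i. i \<notin> S \<longrightarrow> w $ i = v $ i}"

text \<open>
  Both families below are sets of subsets of the ambient space, so their cardinalities count
  distinct polytopes and not the pairs \<open>(v, S)\<close> that give rise to them.  The argument \<open>m\<close> is
  the size of \<open>S\<close>: it is \<open>k + 1\<close> for the simplices of dimension \<open>k\<close>, and \<open>k\<close> for the
  half cubes of dimension \<open>k\<close>.
\<close>

definition simplex_shaped :: "nat \<Rightarrow> (real^'n) set set" where
  "simplex_shaped m = {convex hull (K_set v' S) | v' S. v' \<in> odd_vertices \<and> card S = m}"

definition half_cube_shaped :: "nat \<Rightarrow> (real^'n) set set" where
  "half_cube_shaped m = {convex hull (L_set v S) | v S. v \<in> even_vertices \<and> card S = m}"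

end

theory Submission
  imports Defs
begin

text \<open>
  A nonempty face of the half cube is the hull of the even vertices on which some linear
  functional \<open>a\<close> attains its maximum, because a polyhedron has only exposed faces.  Write
  \<open>a $ i = c i * s $ i\<close> with a vertex \<open>s\<close> of the cube and weights \<open>c i \<ge> 0\<close>.  A vertex that
  differs from \<open>s\<close> exactly in the coordinates \<open>D\<close> has the value
  \<open>(\<Sum>i. c i) - 2 * (\<Sum>i\<in>D. c i)\<close>, so the problem is to choose \<open>D\<close> of least weight subject
  to parity.  If \<open>s\<close> can be taken even, the optimal \<open>D\<close> are the even sets of coordinates of
  weight \<open>0\<close>, and the maximizers form an \<open>L_set\<close> (\<open>maximizers_even_sign\<close>).  Otherwise \<open>s\<close>
  is odd and all weights are positive, the optimal \<open>D\<close> are the singletons of least weight,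
  and the maximizers form a \<open>K_set\<close> (\<open>maximizers_odd_sign\<close>).  Suitable weights produce every
  such set, whence the classification \<open>nonempty_face_of_half_cube_iff\<close>.

  What remains is to sort the faces by dimension and to count them.  A \<open>K_set\<close> on \<open>m\<close>
  coordinates consists of affinely independent points and has dimension \<open>m - 1\<close>.  An \<open>L_set\<close>
  on \<open>m \<ge> 3\<close> coordinates has dimension \<open>m\<close>, while for \<open>m \<le> 1\<close> it is a point and for
  \<open>m = 2\<close> an edge which is also a \<open>K_set\<close>; this is why half cubes appear as a family of
  their own only from dimension 3 on.  Distinct sets of even vertices have distinct hulls
  (\<open>hull_eq_iff_even_vertices\<close>), so the counting takes place among vertex sets.  The index set
  \<open>S\<close> is recovered as the set of coordinates that are not constant, an \<open>L_set\<close> is then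
  determined by the signs outside \<open>S\<close>, and a \<open>K_set\<close> with at least three points by its
  centre (\<open>K_set_centre_unique\<close>).  Edges have two centres each and are counted as \<open>L_set\<close>s.
\<close>

section \<open>Reflecting coordinates\<close>

definition flip :: "'n set \<Rightarrow> real^'n \<Rightarrow> real^'n" where
  "flip A v = (\<chi> i. if i \<in> A then - v $ i else v $ i)"

lemma flip_nth [simp]: "flip A v $ i = (if i \<in> A then - v $ i else v $ i)"
  by (simp add: flip_def)

lemma flip_flip [simp]: "flip A (flip A v) = v"
  by (simp add: vec_eq_iff)

lemma flip_empty [simp]: "flip {} v = v"
  by (simp add: vec_eq_iff)

lemma cube_vertices_nonzero: "v \<in> cube_vertices \<Longrightarrow> v $ i \<noteq> 0"
  by (auto simp: cube_vertices_def dest: spec[of _ i])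

lemma flip_in_cube_vertices [simp]:
  fixes v :: "real^'n"
  shows "flip A v \<in> cube_vertices \<longleftrightarrow> v \<in> cube_vertices"
proof -
  have *: "flip A v \<in> cube_vertices" if "v \<in> cube_vertices" for v :: "real^'n"
    using that by (auto simp: cube_vertices_def)
  from *[of v] *[of "flip A v"] show ?thesis by auto
qed

lemma cube_vertex_eq_flip:
  assumes "v \<in> cube_vertices" "w \<in> cube_vertices"
  shows "w = flip {i. w $ i \<noteq> v $ i} v"
proof -
  have "w $ i = (if w $ i \<noteq> v $ i then - v $ i else v $ i)" for i
  proof -
    have "v $ i = 1 \<or> v $ i = - 1" "w $ i = 1 \<or> w $ i = - 1"
      using assms by (auto simp: cube_vertices_def)
    then show ?thesis by auto
  qed
  then show ?thesis by (simp add: vec_eq_iff)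
qed

lemma flip_inject:
  assumes "v \<in> cube_vertices"
  shows "flip A v = flip B v \<longleftrightarrow> A = B"
proof
  assume eq: "flip A v = flip B v"
  have "i \<in> A \<longleftrightarrow> i \<in> B" for i
    using arg_cong[OF eq, of "\<lambda>x. x $ i"] cube_vertices_nonzero[OF assms, of i]
    by (auto split: if_splits)
  then show "A = B" by blast
qed simp

text \<open>
  The product of the coordinates is multiplicative, so it tracks the parity of the number of
  negative coordinates under reflections without any bookkeeping of symmetric differences.
\<close>

lemma prod_cube_vertex:
  fixes v :: "real^'n"
  assumes "v \<in> cube_vertices"
  shows "(\<Prod>i\<in>UNIV. v $ i) = (- 1) ^ card {i. v $ i < 0}"
proof -
  have "v $ i = (if v $ i < 0 then - 1 else 1)" for i
    using assms by (auto simp: cube_vertices_def dest: spec[of _ i])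
  then have "(\<Prod>i\<in>UNIV. v $ i) = (\<Prod>i\<in>UNIV. if v $ i < 0 then - 1 else 1)"
    by (intro prod.cong) auto
  also have "\<dots> = (- 1) ^ card {i. v $ i < 0}"
    by (simp add: prod.If_cases Int_def)
  finally show ?thesis .
qed

lemma even_vertices_iff_prod:
  fixes v :: "real^'n"
  shows "v \<in> even_vertices \<longleftrightarrow> v \<in> cube_vertices \<and> (\<Prod>i\<in>UNIV. v $ i) = 1"
proof (cases "v \<in> cube_vertices")
  case True
  then show ?thesis
    by (cases "even (card {i. v $ i < 0})") (simp_all add: even_vertices_def prod_cube_vertex)
qed (simp add: even_vertices_def)

lemma odd_vertices_iff_prod:
  fixes v :: "real^'n"
  shows "v \<in> odd_vertices \<longleftrightarrow> v \<in> cube_vertices \<and> (\<Prod>i\<in>UNIV. v $ i) = - 1"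
proof (cases "v \<in> cube_vertices")
  case True
  then show ?thesis
    by (cases "even (card {i. v $ i < 0})")
      (simp_all add: odd_vertices_def even_vertices_def prod_cube_vertex)
qed (simp add: odd_vertices_def)

lemma prod_flip:
  fixes v :: "real^'n"
  shows "(\<Prod>i\<in>UNIV. flip A v $ i) = (- 1) ^ card A * (\<Prod>i\<in>UNIV. v $ i)"
proof -
  have "(\<Prod>i\<in>UNIV. flip A v $ i) = (\<Prod>i\<in>UNIV. (if i \<in> A then - 1 else 1) * v $ i)"
    by (intro prod.cong) auto
  also have "\<dots> = (- 1) ^ card A * (\<Prod>i\<in>UNIV. v $ i)"
    by (simp add: prod.distrib prod.If_cases)
  finally show ?thesis .
qed

lemma even_vertices_subset_cube: "even_vertices \<subseteq> cube_vertices"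
  by (auto simp: even_vertices_def)

lemma odd_vertices_subset_cube: "odd_vertices \<subseteq> cube_vertices"
  by (auto simp: odd_vertices_def)

lemma flip_even_vertex: "v \<in> even_vertices \<Longrightarrow> flip A v \<in> even_vertices \<longleftrightarrow> even (card A)"
  by (cases "even (card A)") (simp_all only: even_vertices_iff_prod prod_flip, simp_all)

lemma flip_odd_vertex: "v \<in> odd_vertices \<Longrightarrow> flip A v \<in> even_vertices \<longleftrightarrow> odd (card A)"
  by (cases "even (card A)")
    (simp_all only: even_vertices_iff_prod odd_vertices_iff_prod prod_flip, simp_all)

lemma flip_even_vertex_odd: "v \<in> even_vertices \<Longrightarrow> flip A v \<in> odd_vertices \<longleftrightarrow> odd (card A)"
  by (cases "even (card A)")
    (simp_all only: even_vertices_iff_prod odd_vertices_iff_prod prod_flip, simp_all)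

lemma K_set_eq_image:
  assumes "v' \<in> odd_vertices"
  shows "K_set v' S = (\<lambda>i. flip {i} v') ` S"
proof (intro set_eqI iffI)
  fix w assume "w \<in> K_set v' S"
  then obtain i where w: "w \<in> even_vertices" "i \<in> S" "{j. w $ j \<noteq> v' $ j} = {i}"
    by (auto simp: K_set_def)
  then have "w = flip {i} v'"
    using cube_vertex_eq_flip[of v' w] assms even_vertices_subset_cube odd_vertices_subset_cube
    by auto
  with w show "w \<in> (\<lambda>i. flip {i} v') ` S" by blast
next
  fix w assume "w \<in> (\<lambda>i. flip {i} v') ` S"
  then obtain i where i: "i \<in> S" "w = flip {i} v'" by blast
  have "v' $ i \<noteq> 0" using assms odd_vertices_subset_cube cube_vertices_nonzero by blast
  then have "{j. w $ j \<noteq> v' $ j} = {i}" using i by auto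
  then show "w \<in> K_set v' S"
    using i flip_odd_vertex[OF assms, of "{i}"] by (auto simp: K_set_def)
qed

lemma L_set_iff_flip:
  assumes "v \<in> even_vertices"
  shows "flip A v \<in> L_set v S \<longleftrightarrow> A \<subseteq> S \<and> even (card A)"
proof -
  have "v $ i \<noteq> 0" for i using assms even_vertices_subset_cube cube_vertices_nonzero by blast
  then have "(\<forall>i. i \<notin> S \<longrightarrow> flip A v $ i = v $ i) \<longleftrightarrow> A \<subseteq> S" by auto
  then show ?thesis by (auto simp: L_set_def flip_even_vertex[OF assms])
qed

lemma L_set_eq_image:
  assumes "v \<in> even_vertices"
  shows "L_set v S = (\<lambda>A. flip A v) ` {A. A \<subseteq> S \<and> even (card A)}"
proof (intro set_eqI iffI)
  fix w assume w: "w \<in> L_set v S"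
  then have "w = flip {j. w $ j \<noteq> v $ j} v"
    using cube_vertex_eq_flip[of v w] assms even_vertices_subset_cube by (auto simp: L_set_def)
  with w L_set_iff_flip[OF assms] show "w \<in> (\<lambda>A. flip A v) ` {A. A \<subseteq> S \<and> even (card A)}"
    by (metis (mono_tags, lifting) image_eqI mem_Collect_eq)
qed (use L_set_iff_flip[OF assms] in auto)

section \<open>Faces as sets of maximizers\<close>

text \<open>
  A vertex \<open>v\<close> of the cube is the unique vertex maximizing \<open>x \<mapsto> v \<bullet> x\<close>, so it lies in the
  hull of no set of other vertices.
\<close>

lemma cube_vertex_in_hull:
  fixes v :: "real^'n"
  assumes "v \<in> cube_vertices" "W \<subseteq> cube_vertices" "v \<in> convex hull W"
  shows "v \<in> W"
proof (rule ccontr)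
  assume "v \<notin> W"
  have "v \<bullet> w < v \<bullet> v" if "w \<in> W" for w
  proof -
    have w: "w \<in> cube_vertices" using that assms by blast
    have "w \<noteq> v" using that \<open>v \<notin> W\<close> by blast
    then obtain i where i: "w $ i \<noteq> v $ i" by (auto simp: vec_eq_iff)
    have pm: "v $ j = 1 \<or> v $ j = - 1" "w $ j = 1 \<or> w $ j = - 1" for j
      using assms w by (auto simp: cube_vertices_def)
    show ?thesis unfolding inner_vec_def
    proof (rule sum_strict_mono_ex1)
      show "\<forall>j\<in>UNIV. v $ j \<bullet> w $ j \<le> v $ j \<bullet> v $ j"
      proof
        fix j show "v $ j \<bullet> w $ j \<le> v $ j \<bullet> v $ j"
          using pm(1)[of j] pm(2)[of j] by auto
      qed
      show "\<exists>j\<in>UNIV. v $ j \<bullet> w $ j < v $ j \<bullet> v $ j"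
        using pm(1)[of i] pm(2)[of i] i by (intro bexI[of _ i]) auto
    qed simp
  qed
  then have "W \<subseteq> {x. v \<bullet> x < v \<bullet> v}" by auto
  then have "convex hull W \<subseteq> {x. v \<bullet> x < v \<bullet> v}"
    by (intro hull_minimal convex_halfspace_lt)
  with assms show False by auto
qed

lemma hull_Int_even_vertices:
  assumes "W \<subseteq> even_vertices"
  shows "convex hull W \<inter> even_vertices = W"
  using assms cube_vertex_in_hull[of _ W] even_vertices_subset_cube hull_subset[of W convex]
  by blast

lemma hull_eq_iff_even_vertices:
  assumes "W \<subseteq> even_vertices" "W' \<subseteq> even_vertices"
  shows "convex hull W = convex hull W' \<longleftrightarrow> W = W'"
  using hull_Int_even_vertices assms by metis

lemma finite_even_vertices: "finite (even_vertices :: (real^'n) set)"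
proof -
  have "(even_vertices :: (real^'n) set) \<subseteq> range (\<lambda>A. flip A (\<chi> i. 1))"
  proof
    fix v :: "real^'n" assume "v \<in> even_vertices"
    then show "v \<in> range (\<lambda>A. flip A (\<chi> i. 1))"
      using cube_vertex_eq_flip[of "\<chi> i. 1" v] even_vertices_subset_cube
      by (auto simp: cube_vertices_def)
  qed
  then show ?thesis by (rule finite_subset) simp
qed

lemma face_of_half_cube_hull:
  assumes "F face_of half_cube"
  shows "F = convex hull (F \<inter> even_vertices)"
proof -
  have "compact (even_vertices :: (real^'n) set)"
    by (rule finite_imp_compact[OF finite_even_vertices])
  then obtain W where "W \<subseteq> even_vertices" "F = convex hull W"
    using face_of_convex_hull_subset assms unfolding half_cube_def by metis
  then show ?thesis by (simp add: hull_Int_even_vertices)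
qed

text \<open>
  The next two lemmas translate between faces and functionals; evaluating a functional on the
  finitely many even vertices is enough.
\<close>

lemma maximizers_hull_face:
  assumes "\<And>w. w \<in> even_vertices \<Longrightarrow> a \<bullet> w \<le> b"
  shows "convex hull {w \<in> even_vertices. a \<bullet> w = b} face_of half_cube"
proof -
  have "half_cube \<subseteq> {x. a \<bullet> x \<le> b}"
    unfolding half_cube_def using assms by (intro hull_minimal convex_halfspace_le) auto
  then have F: "(half_cube \<inter> {x. a \<bullet> x = b}) face_of half_cube"
    by (intro face_of_Int_supporting_hyperplane_le) (auto simp: half_cube_def)
  have "half_cube \<inter> {x. a \<bullet> x = b} \<inter> even_vertices = {w \<in> even_vertices. a \<bullet> w = b}"
    using hull_subset[of even_vertices convex] by (auto simp: half_cube_def)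
  with face_of_half_cube_hull[OF F] F show ?thesis by simp
qed

lemma face_eq_maximizers_hull:
  assumes "F face_of half_cube"
  obtains a b where "\<And>w. w \<in> even_vertices \<Longrightarrow> a \<bullet> w \<le> b"
    and "F = convex hull {w \<in> even_vertices. a \<bullet> w = b}"
proof -
  have "polyhedron (half_cube :: (real^'n) set)"
    unfolding half_cube_def by (intro polytope_imp_polyhedron polytope_convex_hull finite_even_vertices)
  then have "F exposed_face_of half_cube"
    using assms exposed_face_of_polyhedron by blast
  then obtain a b where ab: "half_cube \<subseteq> {x. a \<bullet> x \<le> b}" "F = half_cube \<inter> {x. a \<bullet> x = b}"
    unfolding exposed_face_of_def by blast
  have sub: "even_vertices \<subseteq> half_cube"
    unfolding half_cube_def by (rule hull_subset)
  have "F \<inter> even_vertices = {w \<in> even_vertices. a \<bullet> w = b}"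
    using ab sub by blast
  then have "F = convex hull {w \<in> even_vertices. a \<bullet> w = b}"
    using face_of_half_cube_hull[OF assms] by simp
  moreover have "a \<bullet> w \<le> b" if "w \<in> even_vertices" for w using ab sub that by blast
  ultimately show thesis using that by blast
qed

text \<open>
  Every functional is \<open>\<chi> i. c i * s $ i\<close> for a vertex \<open>s\<close> of the cube, recording signs, and
  weights \<open>c \<ge> 0\<close>.  Moving from \<open>s\<close> to another vertex costs twice the weight of every
  coordinate that changes.
\<close>

lemma inner_weighted_flip:
  fixes s :: "real^'n"
  assumes "s \<in> cube_vertices"
  shows "(\<chi> i. c i * s $ i) \<bullet> flip A s = (\<Sum>i\<in>UNIV. c i) - 2 * (\<Sum>i\<in>A. c i)"
proof -
  have sq: "s $ i * s $ i = 1" for i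
    using assms by (auto simp: cube_vertices_def dest: spec[of _ i])
  have "(\<chi> i. c i * s $ i) \<bullet> flip A s = (\<Sum>i\<in>UNIV. c i - 2 * (if i \<in> A then c i else 0))"
    unfolding inner_vec_def using sq by (intro sum.cong) (auto simp: mult.assoc)
  also have "\<dots> = (\<Sum>i\<in>UNIV. c i) - 2 * (\<Sum>i\<in>A. c i)"
    by (simp add: sum_subtractf sum.If_cases flip: sum_distrib_left)
  finally show ?thesis .
qed

text \<open>
  If the sign vector is even then it is itself optimal, and only coordinates of weight \<open>0\<close> can
  be changed for free.
\<close>

lemma maximizers_even_sign:
  fixes v :: "real^'n"
  assumes v: "v \<in> even_vertices" and c: "\<And>i. 0 \<le> c i" and w: "w \<in> even_vertices"
  shows "(\<chi> i. c i * v $ i) \<bullet> w \<le> sum c UNIV"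
    and "(\<chi> i. c i * v $ i) \<bullet> w = sum c UNIV \<longleftrightarrow> w \<in> L_set v {i. c i = 0}"
proof -
  define D where "D = {i. w $ i \<noteq> v $ i}"
  have wD: "w = flip D v"
    unfolding D_def using v w even_vertices_subset_cube by (intro cube_vertex_eq_flip) auto
  have inner: "(\<chi> i. c i * v $ i) \<bullet> w = sum c UNIV - 2 * sum c D"
    unfolding wD using v even_vertices_subset_cube by (intro inner_weighted_flip) auto
  show "(\<chi> i. c i * v $ i) \<bullet> w \<le> sum c UNIV"
    using inner sum_nonneg[of D c] c by simp
  have "(\<chi> i. c i * v $ i) \<bullet> w = sum c UNIV \<longleftrightarrow> D \<subseteq> {i. c i = 0}"
    unfolding inner using c by (auto simp: sum_nonneg_eq_0_iff)
  also have "\<dots> \<longleftrightarrow> w \<in> L_set v {i. c i = 0}"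
    using L_set_iff_flip[OF v, of D] flip_even_vertex[OF v, of D] w wD by auto
  finally show "(\<chi> i. c i * v $ i) \<bullet> w = sum c UNIV \<longleftrightarrow> w \<in> L_set v {i. c i = 0}" .
qed

text \<open>
  If the sign vector is odd then parity forces at least one change, and with positive weights
  it is best to make exactly one, at a coordinate of least weight.
\<close>

lemma maximizers_odd_sign:
  fixes v' :: "real^'n"
  assumes v': "v' \<in> odd_vertices" and c: "\<And>i. m \<le> c i" and m: "0 < m" and w: "w \<in> even_vertices"
  shows "(\<chi> i. c i * v' $ i) \<bullet> w \<le> sum c UNIV - 2 * m"
    and "(\<chi> i. c i * v' $ i) \<bullet> w = sum c UNIV - 2 * m \<longleftrightarrow> w \<in> K_set v' {i. c i = m}"
proof -
  define D where "D = {i. w $ i \<noteq> v' $ i}"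
  have wD: "w = flip D v'"
    unfolding D_def using v' w even_vertices_subset_cube odd_vertices_subset_cube
    by (intro cube_vertex_eq_flip) auto
  have inner: "(\<chi> i. c i * v' $ i) \<bullet> w = sum c UNIV - 2 * sum c D"
    unfolding wD using v' odd_vertices_subset_cube by (intro inner_weighted_flip) auto
  have "odd (card D)" using flip_odd_vertex[OF v', of D] w wD by simp
  then obtain i where i: "i \<in> D" by (cases "D = {}") auto
  have pos: "0 < c j" for j using c[of j] m by linarith
  have split: "sum c D = c i + sum c (D - {i})"
    using i by (simp add: sum.remove)
  have rest: "0 \<le> sum c (D - {i})" using pos by (intro sum_nonneg) (simp add: less_imp_le)
  show "(\<chi> i. c i * v' $ i) \<bullet> w \<le> sum c UNIV - 2 * m"
    using inner split rest c[of i] by simp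
  show "(\<chi> i. c i * v' $ i) \<bullet> w = sum c UNIV - 2 * m \<longleftrightarrow> w \<in> K_set v' {i. c i = m}"
  proof
    assume "(\<chi> i. c i * v' $ i) \<bullet> w = sum c UNIV - 2 * m"
    then have "c i = m" "sum c (D - {i}) = 0" using inner split rest c[of i] by linarith+
    then have "D - {i} = {}"
      using pos sum_pos[of "D - {i}" c] by (metis finite less_irrefl)
    then have "D = {i}" using i by blast
    then show "w \<in> K_set v' {i. c i = m}"
      using \<open>c i = m\<close> wD by (simp add: K_set_eq_image[OF v'])
  next
    assume "w \<in> K_set v' {i. c i = m}"
    then obtain j where "c j = m" "D = {j}" by (auto simp: K_set_def D_def)
    then show "(\<chi> i. c i * v' $ i) \<bullet> w = sum c UNIV - 2 * m" using inner by simp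
  qed
qed

text \<open>
  A functional with a coordinate of weight \<open>0\<close> leaves that sign free, so its sign vector
  can be taken even.  Only the functionals without zero coordinates and with an odd sign
  vector remain, and these give the simplices.
\<close>

lemma nonempty_face_of_half_cube_iff:
  fixes F :: "(real^'n) set"
  shows "F face_of half_cube \<and> F \<noteq> {} \<longleftrightarrow>
    (\<exists>v S. v \<in> even_vertices \<and> F = convex hull L_set v S) \<or>
    (\<exists>v' S. v' \<in> odd_vertices \<and> S \<noteq> {} \<and> F = convex hull K_set v' S)"
    (is "?face \<longleftrightarrow> ?L \<or> ?K")
proof
  assume face: ?face
  obtain a b where ab: "\<And>w. w \<in> even_vertices \<Longrightarrow> a \<bullet> w \<le> b"
    and F: "F = convex hull {w \<in> even_vertices. a \<bullet> w = b}"
    using face by (blast elim: face_eq_maximizers_hull)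
  have "{w \<in> even_vertices. a \<bullet> w = b} \<noteq> {}" using F face by auto
  then obtain u where u: "u \<in> even_vertices" "a \<bullet> u = b" by blast
  define c where "c i = \<bar>a $ i\<bar>" for i
  define s :: "real^'n" where "s = (\<chi> i. if a $ i < 0 then - 1 else 1)"
  have a_s: "a = (\<chi> i. c i * s $ i)" by (simp add: vec_eq_iff c_def s_def)
  have s: "s \<in> cube_vertices" by (simp add: s_def cube_vertices_def)
  show "?L \<or> ?K"
  proof (cases "\<exists>v\<in>even_vertices. a = (\<chi> i. c i * v $ i)")
    case True
    then obtain v where v: "v \<in> even_vertices" "a = (\<chi> i. c i * v $ i)" by blast
    have c: "0 \<le> c i" for i by (simp add: c_def)
    note max = maximizers_even_sign[of v c, OF v(1) c, folded v(2)]
    have "v \<in> L_set v {i. c i = 0}" using v(1) by (simp add: L_set_def)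
    then have "b = sum c UNIV"
      using max[OF v(1)] max(1)[OF u(1)] ab[OF v(1)] u(2) by linarith
    then have "{w \<in> even_vertices. a \<bullet> w = b} = L_set v {i. c i = 0}"
      using max(2) by (auto simp: L_set_def)
    with F have "F = convex hull L_set v {i. c i = 0}" by simp
    with v(1) have ?L by (intro exI conjI)
    then show ?thesis ..
  next
    case False
    have s_odd: "s \<in> odd_vertices" using False s a_s by (auto simp: odd_vertices_def)
    \<comment> \<open>At a coordinate of weight \<open>0\<close> the sign could be reversed to make \<open>s\<close> even.\<close>
    have c_pos: "0 < c i" for i
    proof (rule ccontr)
      assume "\<not> 0 < c i"
      then have "c i = 0" by (simp add: c_def)
      then have "a = (\<chi> j. c j * flip {i} s $ j)" using a_s by (auto simp: vec_eq_iff)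
      moreover have "flip {i} s \<in> even_vertices" using flip_odd_vertex[OF s_odd, of "{i}"] by simp
      ultimately show False using False by blast
    qed
    define m where "m = Min (range c)"
    have m_le: "m \<le> c i" for i by (simp add: m_def)
    have "m \<in> range c" unfolding m_def by (rule Min_in) auto
    then obtain i where i: "c i = m" by auto
    then have m_pos: "0 < m" using c_pos[of i] by simp
    note max = maximizers_odd_sign[of s m c, OF s_odd m_le m_pos, folded a_s]
    have t: "flip {i} s \<in> even_vertices" "flip {i} s \<in> K_set s {i. c i = m}"
      using flip_odd_vertex[OF s_odd, of "{i}"] i by (auto simp: K_set_eq_image[OF s_odd])
    have "b = sum c UNIV - 2 * m"
      using max[OF t(1)] t(2) max(1)[OF u(1)] ab[OF t(1)] u(2) by linarith
    then have "{w \<in> even_vertices. a \<bullet> w = b} = K_set s {i. c i = m}"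
      using max(2) by (auto simp: K_set_def)
    moreover have "{i. c i = m} \<noteq> {}" using i by blast
    ultimately have "s \<in> odd_vertices" "{i. c i = m} \<noteq> {}" "F = convex hull K_set s {i. c i = m}"
      using F s_odd by simp_all
    then have ?K by (intro exI conjI)
    then show ?thesis ..
  qed
next
  assume "?L \<or> ?K"
  then show ?face
  proof
    assume ?L
    then obtain v S where v: "v \<in> even_vertices" and F: "F = convex hull L_set v S" by blast
    \<comment> \<open>Any weights that vanish exactly on \<open>S\<close> expose this face.\<close>
    define c where "c i = (if i \<in> S then 0 else 1 :: real)" for i
    have c: "0 \<le> c i" for i by (simp add: c_def)
    have S: "{i. c i = 0} = S" by (auto simp: c_def)
    note max = maximizers_even_sign[of v c, OF v c, unfolded S]
    have "L_set v S = {w \<in> even_vertices. (\<chi> i. c i * v $ i) \<bullet> w = sum c UNIV}"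
      using max(2) by (auto simp: L_set_def)
    then have "F face_of half_cube" using F maximizers_hull_face[OF max(1)] by simp
    moreover have "v \<in> L_set v S" using v by (simp add: L_set_def)
    ultimately show ?face using F by auto
  next
    assume ?K
    then obtain v' S where v': "v' \<in> odd_vertices" and S0: "S \<noteq> {}"
      and F: "F = convex hull K_set v' S" by blast
    \<comment> \<open>Any positive weights that are least exactly on \<open>S\<close> expose this face.\<close>
    define c where "c i = (if i \<in> S then 1 else 2 :: real)" for i
    have c: "1 \<le> c i" for i by (simp add: c_def)
    have S: "{i. c i = 1} = S" by (auto simp: c_def)
    note max = maximizers_odd_sign[of v' 1 c, OF v' c zero_less_one, unfolded S]
    have "K_set v' S = {w \<in> even_vertices. (\<chi> i. c i * v' $ i) \<bullet> w = sum c UNIV - 2 * 1}"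
      using max(2) by (auto simp: K_set_def)
    then have "F face_of half_cube" using F maximizers_hull_face[OF max(1)] by simp
    then show ?face using F S0 by (simp add: K_set_eq_image[OF v'])
  qed
qed

section \<open>Dimensions\<close>

text \<open>
  Translating the centre \<open>v'\<close> to the origin turns the points of \<open>K_set v' S\<close> into nonzero
  multiples of distinct axis vectors.
\<close>

lemma aff_dim_K_set:
  fixes v' :: "real^'n"
  assumes v': "v' \<in> odd_vertices"
  shows "aff_dim (K_set v' S) = int (card S) - 1"
proof -
  define g where "g i = (axis i (- 2 * v' $ i) :: real^'n)" for i
  have nz: "v' $ i \<noteq> 0" for i
    using v' odd_vertices_subset_cube cube_vertices_nonzero by blast
  have "flip {i} v' = v' + g i" for i
    by (auto simp: vec_eq_iff g_def axis_def)
  then have K: "K_set v' S = (+) v' ` g ` S"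
    by (simp add: K_set_eq_image[OF v'] image_image)
  have inj: "inj_on g S"
    using nz by (auto simp: inj_on_def g_def axis_eq_axis)
  have "pairwise orthogonal (g ` S)"
    by (auto simp: pairwise_def orthogonal_def g_def inner_axis_axis)
  moreover have "0 \<notin> g ` S" using nz by (auto simp: g_def axis_eq_0_iff)
  ultimately have "independent (g ` S)" by (rule pairwise_orthogonal_independent)
  then have "\<not> affine_dependent (g ` S)" using affine_dependent_imp_dependent by blast
  then have "aff_dim (g ` S) = int (card (g ` S)) - 1" 
    using aff_dim_affine_independent[of "g ` S"] by linarith
  then show ?thesis
    unfolding K aff_dim_translation_eq by (simp add: card_image[OF inj])
qed

lemma L_set_small:
  assumes v: "v \<in> even_vertices" and S: "card S \<le> 1"
  shows "L_set v S = {v}"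
proof -
  have "A = {}" if "A \<subseteq> S" "even (card A)" for A
  proof -
    have "card A \<le> 1" using card_mono[of S A] that S by simp
    with that show "A = {}" by (cases "card A") auto
  qed
  then have "{A. A \<subseteq> S \<and> even (card A)} = {{}}" by auto
  then show ?thesis by (simp add: L_set_eq_image[OF v])
qed

lemma L_set_pair:
  assumes v: "v \<in> even_vertices" and "i \<noteq> j"
  shows "L_set v {i, j} = K_set (flip {i} v) {i, j}"
proof -
  have "{A. A \<subseteq> {i, j} \<and> even (card A)} = {A \<in> {{}, {i}, {j}, {i, j}}. even (card A)}"
    by (simp add: set_eq_iff[of "Collect _"] Pow_insert insert_commute flip: Pow_iff)
  also have "\<dots> = {{}, {i, j}}"
    using \<open>i \<noteq> j\<close> by auto
  finally have "{A. A \<subseteq> {i, j} \<and> even (card A)} = {{}, {i, j}}" .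
  then have "L_set v {i, j} = {v, flip {i, j} v}" by (simp add: L_set_eq_image[OF v])
  moreover have "flip {i} v \<in> odd_vertices" by (simp add: flip_even_vertex_odd[OF v])
  moreover have "flip {j} (flip {i} v) = flip {i, j} v"
    using \<open>i \<noteq> j\<close> by (auto simp: vec_eq_iff)
  ultimately show ?thesis by (simp add: K_set_eq_image)
qed

text \<open>
  Reflecting a pair of coordinates moves \<open>v\<close> by \<open>g i + g j\<close>, where \<open>g i\<close> is a multiple of the
  \<open>i\<close>-th axis vector.  With a third index available,
  \<open>2 g i = (g i + g j) + (g i + g k) - (g j + g k)\<close>, so all axis directions in \<open>S\<close> occur.
  For two indices only the single direction \<open>g i + g j\<close> exists, which is why edges behave
  differently.
\<close>

lemma aff_dim_L_set:
  fixes v :: "real^'n"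
  assumes v: "v \<in> even_vertices" and S: "3 \<le> card S"
  shows "aff_dim (L_set v S) = int (card S)"
proof -
  define g where "g i = (axis i (- 2 * v $ i) :: real^'n)" for i
  have nz: "v $ i \<noteq> 0" for i
    using v even_vertices_subset_cube cube_vertices_nonzero by blast
  have inj: "inj_on g S"
    using nz by (auto simp: inj_on_def g_def axis_eq_axis)
  have "pairwise orthogonal (g ` S)"
    by (auto simp: pairwise_def orthogonal_def g_def inner_axis_axis)
  moreover have "0 \<notin> g ` S" using nz by (auto simp: g_def axis_eq_0_iff)
  ultimately have indep: "independent (g ` S)" by (rule pairwise_orthogonal_independent)
  define M where "M = (+) (- v) ` L_set v S"
  have flip_g: "- v + flip A v = (\<Sum>i\<in>A. g i)" for A
    by (auto simp: vec_eq_iff g_def axis_def if_distrib sum.delta cong: if_cong)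
  have M: "M = (\<lambda>A. \<Sum>i\<in>A. g i) ` {A. A \<subseteq> S \<and> even (card A)}"
    unfolding M_def L_set_eq_image[OF v] image_image flip_g ..
  have pair: "g i + g j \<in> span M" if "i \<in> S" "j \<in> S" "i \<noteq> j" for i j
  proof -
    have "(\<Sum>i\<in>{i, j}. g i) \<in> M" unfolding M using that by (intro imageI) auto
    then show ?thesis using that by (simp add: span_base)
  qed
  have "g i \<in> span M" if i: "i \<in> S" for i
  proof -
    have "2 \<le> card (S - {i})" using S i by simp
    then obtain T where T: "T \<subseteq> S - {i}" "card T = 2"
      by (rule obtain_subset_with_card_n) blast
    from T(2) obtain j k where "T = {j, k}" "j \<noteq> k" by (meson card_2_iff)
    with T(1) have jk: "j \<in> S" "k \<in> S" "j \<noteq> k" "i \<noteq> j" "i \<noteq> k" by auto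
    have "(1 / 2) *\<^sub>R ((g i + g j) + (g i + g k) - (g j + g k)) \<in> span M"
      using i jk by (intro span_scale span_diff span_add pair)
    moreover have "(1 / 2) *\<^sub>R ((g i + g j) + (g i + g k) - (g j + g k)) = g i"
      by (simp add: vec_eq_iff)
    ultimately show ?thesis by simp
  qed
  then have "g ` S \<subseteq> span M" by blast
  moreover have "M \<subseteq> span (g ` S)"
    unfolding M by (auto intro!: span_sum intro: span_base)
  ultimately have "span M = span (g ` S)" by (metis span_minimal span_subspace subspace_span)
  then have "dim M = card (g ` S)"
    using indep by (metis dim_eq_card)
  moreover have "v \<in> affine hull L_set v S"
    using v by (intro hull_inc) (simp add: L_set_def)
  ultimately show ?thesis
    using aff_dim_eq_dim[of v "L_set v S"] card_image[OF inj] by (simp add: M_def)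
qed

section \<open>Counting\<close>

lemma card_cube_vertices: "card (cube_vertices :: (real^'n) set) = 2 ^ CARD('n)"
proof -
  let ?o = "(\<chi> i. 1) :: real^'n"
  have o: "?o \<in> cube_vertices" by (simp add: cube_vertices_def)
  have "bij_betw (\<lambda>A. flip A ?o) UNIV cube_vertices"
    unfolding bij_betw_def
  proof
    show "inj (\<lambda>A. flip A ?o)" using flip_inject[OF o] by (simp add: inj_on_def)
    show "range (\<lambda>A. flip A ?o) = cube_vertices"
      using o cube_vertex_eq_flip[OF o] by (auto intro: range_eqI)
  qed
  then have "card (cube_vertices :: (real^'n) set) = card (UNIV :: 'n set set)"
    using bij_betw_same_card by metis
  then show ?thesis by (simp add: card_Pow flip: Pow_UNIV)
qed

lemma card_odd_vertices: "card (odd_vertices :: (real^'n) set) = 2 ^ (CARD('n) - 1)"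
  and card_even_vertices: "card (even_vertices :: (real^'n) set) = 2 ^ (CARD('n) - 1)"
proof -
  fix i :: 'n
  have "bij_betw (flip {i}) even_vertices odd_vertices"
    by (rule bij_betwI[where g = "flip {i}"]) (auto simp: flip_even_vertex_odd flip_odd_vertex)
  then have eq: "card (even_vertices :: (real^'n) set) = card (odd_vertices :: (real^'n) set)"
    by (rule bij_betw_same_card)
  have "finite (cube_vertices :: (real^'n) set)"
    by (rule card_ge_0_finite) (simp add: card_cube_vertices)
  then have "card (odd_vertices :: (real^'n) set) + card (even_vertices :: (real^'n) set)
      = 2 ^ CARD('n)"
    using even_vertices_subset_cube card_cube_vertices
    by (metis add.commute card_Diff_subset card_mono finite_even_vertices le_add_diff_inverse odd_vertices_def)
  moreover have "(2::nat) ^ CARD('n) = 2 * 2 ^ (CARD('n) - 1)"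
    by (metis zero_less_card_finite power_eq_if less_not_refl)
  ultimately show "card (odd_vertices :: (real^'n) set) = 2 ^ (CARD('n) - 1)"
    "card (even_vertices :: (real^'n) set) = 2 ^ (CARD('n) - 1)"
    using eq by simp_all
qed

definition varying_coords :: "(real^'n) set \<Rightarrow> 'n set" where
  "varying_coords W = {i. \<exists>w\<in>W. \<exists>w'\<in>W. w $ i \<noteq> w' $ i}"

lemma varying_coords_K_set:
  assumes v': "v' \<in> odd_vertices" and S: "2 \<le> card S"
  shows "varying_coords (K_set v' S) = S"
proof -
  have nz: "v' $ i \<noteq> 0" for i
    using v' odd_vertices_subset_cube cube_vertices_nonzero by blast
  have "\<exists>w\<in>K_set v' S. \<exists>w'\<in>K_set v' S. w $ i \<noteq> w' $ i" if i: "i \<in> S" for i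
  proof -
    have "S \<noteq> {i}" using S by auto
    then obtain j where "j \<in> S" "j \<noteq> i" using i by blast
    then have "flip {i} v' \<in> K_set v' S" "flip {j} v' \<in> K_set v' S"
      "flip {i} v' $ i \<noteq> flip {j} v' $ i"
      using i nz[of i] by (auto simp: K_set_eq_image[OF v'])
    then show ?thesis by blast
  qed
  moreover have "w $ i = w' $ i" if "w \<in> K_set v' S" "w' \<in> K_set v' S" "i \<notin> S" for w w' i
    using that by (auto simp: K_set_eq_image[OF v'])
  ultimately show ?thesis by (auto simp: varying_coords_def)
qed

lemma varying_coords_L_set:
  assumes v: "v \<in> even_vertices" and S: "2 \<le> card S"
  shows "varying_coords (L_set v S) = S"
proof -
  have nz: "v $ i \<noteq> 0" for i
    using v even_vertices_subset_cube cube_vertices_nonzero by blast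
  have "\<exists>w\<in>L_set v S. \<exists>w'\<in>L_set v S. w $ i \<noteq> w' $ i" if i: "i \<in> S" for i
  proof -
    have "S \<noteq> {i}" using S by auto
    then obtain j where "j \<in> S" "j \<noteq> i" using i by blast
    then have "flip {i, j} v \<in> L_set v S" "v \<in> L_set v S" "flip {i, j} v $ i \<noteq> v $ i"
      using i nz[of i] v L_set_iff_flip[OF v, of "{i, j}"] by (auto simp: L_set_def)
    then show ?thesis by blast
  qed
  moreover have "w $ i = w' $ i" if "w \<in> L_set v S" "w' \<in> L_set v S" "i \<notin> S" for w w' i
    using that by (simp add: L_set_def)
  ultimately show ?thesis by (auto simp: varying_coords_def)
qed

lemma K_set_subset_even: "K_set v' S \<subseteq> even_vertices"
  by (auto simp: K_set_def)

lemma L_set_subset_even: "L_set v S \<subseteq> even_vertices"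
  by (auto simp: L_set_def)

text \<open>
  If \<open>u'\<close> and \<open>v'\<close> were different centres of one simplex, then each vertex of it would be
  obtained from both by one reflection, so every \<open>i \<in> S\<close> would be among the at most two
  coordinates in which \<open>u'\<close> and \<open>v'\<close> differ.
\<close>

lemma K_set_centre_unique:
  assumes v': "v' \<in> odd_vertices" and u': "u' \<in> odd_vertices" and S: "3 \<le> card S"
    and eq: "K_set v' S = K_set u' T"
  shows "v' = u'"
proof (rule ccontr)
  assume ne: "v' \<noteq> u'"
  define D where "D = {j. v' $ j \<noteq> u' $ j}"
  have step: "i \<in> D \<and> card D \<le> 2" if i: "i \<in> S" for i
  proof -
    have "flip {i} v' \<in> K_set u' T" using i by (auto simp: K_set_eq_image[OF v'] simp flip: eq)
    then obtain j where j: "flip {i} v' = flip {j} u'" by (auto simp: K_set_eq_image[OF u'])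
    have "i \<noteq> j" using j ne by (metis flip_flip)
    have nz: "v' $ i \<noteq> 0"
      using v' odd_vertices_subset_cube cube_vertices_nonzero by blast
    have at: "flip {i} v' $ l = flip {j} u' $ l" for l using j by simp
    have "i \<in> D" using at[of i] nz \<open>i \<noteq> j\<close> by (auto simp: D_def)
    moreover have "l \<in> {i, j}" if "l \<in> D" for l
      using that at[of l] by (auto simp: D_def split: if_splits)
    then have "card D \<le> card {i, j}" by (intro card_mono) auto
    ultimately show ?thesis using \<open>i \<noteq> j\<close> by simp
  qed
  then have "card S \<le> card D" by (intro card_mono) auto
  moreover have "S \<noteq> {}" using S by auto
  ultimately show False using step S by fastforce
qed

lemma card_simplex_shaped:
  assumes "3 \<le> m"
  shows "card (simplex_shaped m :: (real^'n) set set) = 2 ^ (CARD('n) - 1) * (CARD('n) choose m)"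
proof -
  let ?I = "odd_vertices \<times> {S :: 'n set. card S = m}"
  let ?f = "\<lambda>(v', S). convex hull K_set v' S :: (real^'n) set"
  have "simplex_shaped m = ?f ` ?I" by (auto simp: simplex_shaped_def image_def)
  moreover have "inj_on ?f ?I"
  proof (rule inj_onI, clarify)
    fix v' u' :: "real^'n" and S T :: "'n set"
    assume v': "v' \<in> odd_vertices" and u': "u' \<in> odd_vertices"
      and m: "m = card S" "card T = card S"
      and hull: "convex hull K_set v' S = convex hull K_set u' T"
    have eq: "K_set v' S = K_set u' T"
      using hull by (simp add: hull_eq_iff_even_vertices K_set_subset_even)
    have "v' = u'" using K_set_centre_unique[OF v' u' _ eq] assms m by simp
    moreover have "S = T"
      using varying_coords_K_set[OF v', of S] varying_coords_K_set[OF u', of T] eq assms m by simp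
    ultimately show "v' = u' \<and> S = T" by blast
  qed
  moreover have "card {S :: 'n set. card S = m} = CARD('n) choose m"
    using n_subsets[of "UNIV :: 'n set" m] by simp
  ultimately show ?thesis
    by (simp add: card_image card_cartesian_product card_odd_vertices)
qed

text \<open>
  The set \<open>L_set v S\<close> depends only on the signs of \<open>v\<close> outside \<open>S\<close>, that is, on a subset of
  the complement of \<open>S\<close>; for nonempty \<open>S\<close> every such sign pattern extends to an even vertex.
\<close>

lemma card_half_cube_shaped:
  assumes k: "2 \<le> k"
  shows "card (half_cube_shaped k :: (real^'n) set set) = 2 ^ (CARD('n) - k) * (CARD('n) choose k)"
proof -
  let ?I = "SIGMA S : {S :: 'n set. card S = k}. Pow (- S)"
  define p :: "'n set \<Rightarrow> real^'n" where "p B = flip B (\<chi> i. 1)" for B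
  have p_nth: "p B $ i = (if i \<in> B then - 1 else 1)" for B i by (simp add: p_def)
  have p_cube: "p B \<in> cube_vertices" for B by (simp add: cube_vertices_def p_nth)
  let ?f = "\<lambda>(S, B). convex hull L_set (p B) S"
  have cong: "L_set u S = L_set v S" if "\<And>i. i \<notin> S \<Longrightarrow> u $ i = v $ i" for u v :: "real^'n" and S
    using that by (auto simp: L_set_def)
  \<comment> \<open>If \<open>p B\<close> is odd, reversing one coordinate inside \<open>S\<close> repairs the parity.\<close>
  have ext: "\<exists>v\<in>even_vertices. (\<forall>i. i \<notin> S \<longrightarrow> v $ i = p B $ i) \<and> L_set (p B) S = L_set v S"
    if "card S = k" for S B
  proof (cases "p B \<in> even_vertices")
    case False
    have "S \<noteq> {}" using k that by auto
    then obtain i where i: "i \<in> S" by blast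
    have "p B \<in> odd_vertices" using False p_cube by (simp add: odd_vertices_def)
    then have "flip {i} (p B) \<in> even_vertices" by (simp add: flip_odd_vertex)
    moreover have agree: "flip {i} (p B) $ j = p B $ j" if "j \<notin> S" for j using i that by auto
    ultimately show ?thesis using cong[of S "p B" "flip {i} (p B)"] by metis
  qed blast
  have "half_cube_shaped k = ?f ` ?I"
  proof (intro set_eqI iffI)
    fix F :: "(real^'n) set" assume "F \<in> half_cube_shaped k"
    then obtain v S where v: "v \<in> even_vertices" "card S = k" "F = convex hull L_set v S"
      by (auto simp: half_cube_shaped_def)
    define B where "B = {i. v $ i < 0} - S"
    have pm: "v $ i = 1 \<or> v $ i = - 1" for i
      using v(1) by (auto simp: even_vertices_def cube_vertices_def)
    have "v $ i = p B $ i" if "i \<notin> S" for i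
      using that pm[of i] by (auto simp: p_nth B_def)
    then have "L_set v S = L_set (p B) S" by (rule cong)
    then show "F \<in> ?f ` ?I" using v by (intro image_eqI[of _ _ "(S, B)"]) (auto simp: B_def)
  next
    fix F :: "(real^'n) set" assume "F \<in> ?f ` ?I"
    then obtain S B where SB: "card S = k" "F = convex hull L_set (p B) S" by auto
    obtain v where "v \<in> even_vertices" "L_set (p B) S = L_set v S"
      using ext[OF SB(1), of B] by blast
    with SB show "F \<in> half_cube_shaped k" unfolding half_cube_shaped_def by auto
  qed
  moreover have "inj_on ?f ?I"
  proof (rule inj_onI, clarify)
    fix S T B C :: "'n set"
    assume kS: "k = card S" and card: "card T = card S" and BC: "B \<subseteq> - S" "C \<subseteq> - T"
      and hull: "convex hull L_set (p B) S = convex hull L_set (p C) T"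
    have eq: "L_set (p B) S = L_set (p C) T"
      using hull by (simp add: hull_eq_iff_even_vertices L_set_subset_even)
    obtain v where v: "v \<in> even_vertices" "L_set (p B) S = L_set v S"
      "\<And>i. i \<notin> S \<Longrightarrow> v $ i = p B $ i"
      using ext[OF kS[symmetric], of B] by blast
    obtain u where u: "u \<in> even_vertices" "L_set (p C) T = L_set u T"
    proof -
      have "card T = k" using card kS by simp
      from ext[OF this, of C] show thesis by (elim bexE conjE) (rule that)
    qed
    have "2 \<le> card S" "2 \<le> card T" using k kS card by simp_all
    then have "varying_coords (L_set v S) = S" "varying_coords (L_set u T) = T"
      using v(1) u(1) by (simp_all only: varying_coords_L_set)
    moreover have "L_set v S = L_set u T" using v(2) u(2) eq by argo
    ultimately have ST: "S = T" by argo
    have "v \<in> L_set (p C) T" using v eq by (auto simp: L_set_def)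
    then have agree: "p B $ i = p C $ i" if "i \<notin> S" for i
      using that v(3) ST by (auto simp: L_set_def)
    have "i \<in> B \<longleftrightarrow> i \<in> C" if "i \<notin> S" for i
      using agree[OF that] by (auto simp: p_nth split: if_splits)
    then show "S = T \<and> B = C" using BC ST by blast
  qed
  moreover have "card ?I = 2 ^ (CARD('n) - k) * (CARD('n) choose k)"
  proof -
    have "card ?I = (\<Sum>S\<in>{S :: 'n set. card S = k}. 2 ^ (CARD('n) - k))"
      by (simp add: card_Pow Compl_eq_Diff_UNIV card_Diff_subset)
    also have "\<dots> = 2 ^ (CARD('n) - k) * (CARD('n) choose k)"
      using n_subsets[of "UNIV :: 'n set" k] by simp
    finally show ?thesis .
  qed
  ultimately show ?thesis by (simp add: card_image)
qed

section \<open>The faces of each dimension\<close>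

lemma k_faces_half_cube:
  "k_faces (half_cube :: (real^'n) set) k = simplex_shaped (k + 1) \<union>
    {convex hull L_set v S | v S. v \<in> even_vertices \<and> aff_dim (L_set v S) = int k}"
  (is "_ = _ \<union> ?Ls")
proof (intro equalityI subsetI)
  fix F :: "(real^'n) set"
  assume "F \<in> k_faces half_cube k"
  then have face: "F face_of half_cube \<and> F \<noteq> {}" and dim: "aff_dim F = int k"
    by (auto simp: k_faces_def)
  from face[unfolded nonempty_face_of_half_cube_iff] show "F \<in> simplex_shaped (k + 1) \<union> ?Ls"
  proof (elim disjE exE conjE)
    fix v S assume "v \<in> even_vertices" "F = convex hull L_set v S"
    with dim have "F \<in> ?Ls" by (auto simp: aff_dim_convex_hull)
    then show ?thesis ..
  next
    fix v' S assume v': "v' \<in> odd_vertices" "F = convex hull K_set v' S"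
    with dim have "card S = k + 1" by (simp add: aff_dim_convex_hull aff_dim_K_set)
    with v' have "F \<in> simplex_shaped (k + 1)" unfolding simplex_shaped_def by auto
    then show ?thesis ..
  qed
next
  fix F assume "F \<in> simplex_shaped (k + 1) \<union> ?Ls"
  then have "(F face_of half_cube \<and> F \<noteq> {}) \<and> aff_dim F = int k"
  proof
    assume "F \<in> simplex_shaped (k + 1)"
    then obtain v' S where v': "v' \<in> odd_vertices" "card S = k + 1" "F = convex hull K_set v' S"
      by (auto simp: simplex_shaped_def)
    then have "S \<noteq> {}" by auto
    with v' show ?thesis
      unfolding nonempty_face_of_half_cube_iff
      by (intro conjI disjI2 exI[of _ v'] exI[of _ S]) (simp_all add: aff_dim_convex_hull aff_dim_K_set)
  next
    assume "F \<in> ?Ls"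
    then obtain v S where v: "v \<in> even_vertices" "aff_dim (L_set v S) = int k"
      "F = convex hull L_set v S" by auto
    then show ?thesis
      unfolding nonempty_face_of_half_cube_iff
      by (intro conjI disjI1 exI[of _ v] exI[of _ S]) (simp_all add: aff_dim_convex_hull)
  qed
  then show "F \<in> k_faces half_cube k" by (simp add: k_faces_def)
qed

lemma L_set_pair_is_K_set:
  assumes v: "v \<in> even_vertices" and S: "card S = 2"
  obtains v' where "v' \<in> odd_vertices" "L_set v S = K_set v' S"
proof -
  obtain i j where S: "S = {i, j}" "i \<noteq> j" using S by (auto simp: card_2_iff)
  have "L_set v S = K_set (flip {i} v) S" unfolding S(1) using v S(2) by (rule L_set_pair)
  moreover have "flip {i} v \<in> odd_vertices" by (simp add: flip_even_vertex_odd[OF v])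
  ultimately show thesis using that by blast
qed

lemma aff_dim_L_set_cases:
  assumes v: "v \<in> even_vertices"
  shows "aff_dim (L_set v S) = (if card S \<le> 1 then 0 else if card S = 2 then 1 else int (card S))"
proof -
  consider "card S \<le> 1" | "card S = 2" | "3 \<le> card S" by linarith
  then show ?thesis
  proof cases
    case 2
    then obtain v' where "v' \<in> odd_vertices" "L_set v S = K_set v' S"
      using L_set_pair_is_K_set[OF v] by blast
    then show ?thesis using 2 by (simp add: aff_dim_K_set)
  qed (use v in \<open>auto simp: L_set_small aff_dim_L_set\<close>)
qed

text \<open>
  The segment from \<open>v\<close> to \<open>flip {i, j} v\<close> has the two odd vertices \<open>flip {i} v\<close> and
  \<open>flip {j} v\<close> as centres, but it is an \<open>L_set\<close> in an essentially unique way.  The number of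
  edges therefore comes from the count of half cube shaped faces.
\<close>

lemma edges_eq: "simplex_shaped 2 = (half_cube_shaped 2 :: (real^'n) set set)"
proof (intro equalityI subsetI)
  fix F :: "(real^'n) set" assume "F \<in> half_cube_shaped 2"
  then obtain v S where v: "v \<in> even_vertices" "card S = 2" "F = convex hull L_set v S"
    by (auto simp: half_cube_shaped_def)
  obtain v' where "v' \<in> odd_vertices" "L_set v S = K_set v' S"
    using v(1,2) by (rule L_set_pair_is_K_set)
  with v show "F \<in> simplex_shaped 2" unfolding simplex_shaped_def by auto
next
  fix F :: "(real^'n) set" assume "F \<in> simplex_shaped 2"
  then obtain v' S where v': "v' \<in> odd_vertices" "card S = 2" "F = convex hull K_set v' S"
    by (auto simp: simplex_shaped_def)
  then obtain i j where ij: "S = {i, j}" "i \<noteq> j" by (auto simp: card_2_iff)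
  have "flip {i} v' \<in> even_vertices" using v' by (simp add: flip_odd_vertex)
  moreover have "L_set (flip {i} v') S = K_set v' S"
    using L_set_pair[OF calculation ij(2)] ij(1) by simp
  ultimately show "F \<in> half_cube_shaped 2"
    using v' unfolding half_cube_shaped_def
    by (intro CollectI exI[of _ "flip {i} v'"] exI[of _ S]) simp
qed

lemma simplex_shaped_1: "simplex_shaped 1 = (\<lambda>v :: real^'n. {v}) ` even_vertices"
proof (intro equalityI subsetI)
  fix F :: "(real^'n) set" assume "F \<in> simplex_shaped 1"
  then obtain v' S where v': "v' \<in> odd_vertices" "card S = 1" "F = convex hull K_set v' S"
    by (auto simp: simplex_shaped_def)
  then obtain i where "S = {i}" by (auto simp: card_1_singleton_iff)
  with v' show "F \<in> (\<lambda>v. {v}) ` even_vertices"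
    by (auto simp: K_set_eq_image flip_odd_vertex)
next
  fix F :: "(real^'n) set" assume "F \<in> (\<lambda>v. {v}) ` even_vertices"
  then obtain v where v: "v \<in> even_vertices" "F = {v}" by blast
  fix i :: 'n
  have v': "flip {i} v \<in> odd_vertices" using v by (simp add: flip_even_vertex_odd)
  have "F = convex hull K_set (flip {i} v) {i}" by (simp add: v K_set_eq_image[OF v'])
  with v' show "F \<in> simplex_shaped 1" unfolding simplex_shaped_def by force
qed

lemma vertices_half_cube: "k_faces (half_cube :: (real^'n) set) 0 = (\<lambda>v. {v}) ` even_vertices"
proof -
  have "convex hull L_set v S = {v}" if "v \<in> even_vertices" "aff_dim (L_set v S) = int 0"
    for v :: "real^'n" and S
  proof -
    have "card S \<le> 1" using that by (simp add: aff_dim_L_set_cases split: if_splits)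
    then show ?thesis using that by (simp add: L_set_small)
  qed
  then have "{convex hull L_set v S | v S. v \<in> even_vertices \<and> aff_dim (L_set v S) = int 0}
      \<subseteq> (\<lambda>v :: real^'n. {v}) ` even_vertices" by blast
  then show ?thesis
    unfolding k_faces_half_cube by (simp only: add_0 simplex_shaped_1 Un_absorb2)
qed

lemma edges_half_cube: "k_faces (half_cube :: (real^'n) set) 1 = simplex_shaped 2"
proof -
  have "aff_dim (L_set v S) = int 1 \<longleftrightarrow> card S = 2" if "v \<in> even_vertices"
    for v :: "real^'n" and S
    using that by (simp add: aff_dim_L_set_cases)
  then have "{convex hull L_set v S | v S. v \<in> even_vertices \<and> aff_dim (L_set v S) = int 1}
      = (half_cube_shaped 2 :: (real^'n) set set)"
    unfolding half_cube_shaped_def by metis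
  then show ?thesis
    unfolding k_faces_half_cube by (simp only: one_add_one edges_eq Un_absorb)
qed

lemma triangles_half_cube: "k_faces (half_cube :: (real^'n) set) 2 = simplex_shaped 3"
proof -
  have "aff_dim (L_set v S) \<noteq> int 2" if "v \<in> even_vertices" for v :: "real^'n" and S
    using that by (simp add: aff_dim_L_set_cases)
  then show ?thesis unfolding k_faces_half_cube by auto
qed

lemma k_faces_half_cube_ge_3:
  assumes "3 \<le> k"
  shows "k_faces (half_cube :: (real^'n) set) k = simplex_shaped (k + 1) \<union> half_cube_shaped k"
proof -
  have "v \<in> even_vertices \<and> aff_dim (L_set v S) = int k \<longleftrightarrow> v \<in> even_vertices \<and> card S = k"
    for v :: "real^'n" and S
    using assms by (auto simp: aff_dim_L_set_cases split: if_splits)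
  then show ?thesis unfolding k_faces_half_cube half_cube_shaped_def by simp
qed

text \<open>
  The coordinates that vary on a common face would number both \<open>k + 1\<close> and \<open>k\<close>.  This also
  separates the two kinds of tetrahedra in dimension 3, which are congruent.
\<close>

lemma simplex_half_cube_shaped_disjoint:
  assumes "2 \<le> k"
  shows "(simplex_shaped (k + 1) :: (real^'n) set set) \<inter> half_cube_shaped k = {}"
proof (rule ccontr)
  assume "\<not> ?thesis"
  then obtain v' S v T where *: "v' \<in> odd_vertices" "card S = k + 1" "v \<in> even_vertices" "card T = k"
    and hull: "convex hull K_set v' S = convex hull (L_set v T :: (real^'n) set)"
    unfolding simplex_shaped_def half_cube_shaped_def by blast
  have "K_set v' S = L_set v T"
    using hull by (simp add: hull_eq_iff_even_vertices K_set_subset_even L_set_subset_even)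
  then have "S = T"
    using varying_coords_K_set[of v' S] varying_coords_L_set[of v T] * assms by simp
  with * show False by simp
qed

theorem theorem2p3p6:
  assumes "CARD('n::finite) \<ge> 4"
  shows
    "(k_faces (half_cube :: (real^'n) set) 0 = (\<lambda>v. {v}) ` even_vertices
       \<and> card (k_faces (half_cube :: (real^'n) set) 0) = 2 ^ (CARD('n) - 1))
     \<and> (k_faces (half_cube :: (real^'n) set) 1 = simplex_shaped 2
       \<and> card (simplex_shaped 2 :: (real^'n) set set) = 2 ^ (CARD('n) - 2) * (CARD('n) choose 2))
     \<and> (k_faces (half_cube :: (real^'n) set) 2 = simplex_shaped 3
       \<and> card (simplex_shaped 3 :: (real^'n) set set) = 2 ^ (CARD('n) - 1) * (CARD('n) choose 3))
     \<and> (\<forall>k. 3 \<le> k \<and> k < CARD('n) \<longrightarrow>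
       k_faces (half_cube :: (real^'n) set) k = simplex_shaped (k + 1) \<union> half_cube_shaped k
       \<and> (simplex_shaped (k + 1) :: (real^'n) set set) \<inter> half_cube_shaped k = {}
       \<and> card (simplex_shaped (k + 1) :: (real^'n) set set)
           = 2 ^ (CARD('n) - 1) * (CARD('n) choose (k + 1))
       \<and> card (half_cube_shaped k :: (real^'n) set set)
           = 2 ^ (CARD('n) - k) * (CARD('n) choose k))"
proof (intro conjI allI impI; (elim conjE)?)
  show "k_faces (half_cube :: (real^'n) set) 0 = (\<lambda>v. {v}) ` even_vertices"
    by (rule vertices_half_cube)
  show "card (k_faces (half_cube :: (real^'n) set) 0) = 2 ^ (CARD('n) - 1)"
    by (simp add: vertices_half_cube card_image card_even_vertices)
  show "k_faces (half_cube :: (real^'n) set) 1 = simplex_shaped 2"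
    by (rule edges_half_cube)
  show "card (simplex_shaped 2 :: (real^'n) set set) = 2 ^ (CARD('n) - 2) * (CARD('n) choose 2)"
    by (simp add: edges_eq card_half_cube_shaped)
  show "k_faces (half_cube :: (real^'n) set) 2 = simplex_shaped 3"
    by (rule triangles_half_cube)
  show "card (simplex_shaped 3 :: (real^'n) set set) = 2 ^ (CARD('n) - 1) * (CARD('n) choose 3)"
    by (simp add: card_simplex_shaped)
next
  fix k :: nat assume k: "3 \<le> k"
  show "k_faces (half_cube :: (real^'n) set) k = simplex_shaped (k + 1) \<union> half_cube_shaped k"
    using k by (rule k_faces_half_cube_ge_3)
  show "(simplex_shaped (k + 1) :: (real^'n) set set) \<inter> half_cube_shaped k = {}"
    using k by (intro simplex_half_cube_shaped_disjoint) simp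
  show "card (simplex_shaped (k + 1) :: (real^'n) set set)
      = 2 ^ (CARD('n) - 1) * (CARD('n) choose (k + 1))"
    using k by (intro card_simplex_shaped) simp
  show "card (half_cube_shaped k :: (real^'n) set set) = 2 ^ (CARD('n) - k) * (CARD('n) choose k)"
    using k by (intro card_half_cube_shaped) simp
qed

end
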